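(* Let $X\in\mathbb{R}^{n\times m}$ and let $k\ge1$ be an integer with $k<\min(m+1,n)$. Then $X$ is strictly $k$-sign consistent if and only if $X$ is strictly $(k-1)$-variation bounding.
   Context: A matrix $X\in\mathbb{R}^{n\times m}$ is strictly $k$-sign consistent if all its $k\times k$ minors are positive, or all its $k\times k$ minors are negative. For a real vector $u\neq0$, $S^-(u)$ is the number of sign changes in $u$ after deleting all zero entries, and $S^-(0):=-1$. $S^+(u)$ is the maximal number of sign changes obtainable after replacing each zero entry of $u$ by a nonzero real number. $X$ is strictly $j$-variation bounding ($j\in\mathbb{Z}_{\ge0}$) if $S^+(Xu)\le j$ for all $u\in\mathbb{R}^m\setminus\{0\}$ with $S^-(u)\le j$. *)

theory Defs
  imports "Jordan_Normal_Form.Determinant" "Jordan_Normal_Form.DL_Submatrix"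
begin

text \<open>Rows and columns are indexed from 0.\<close>

definition strictly_sign_consistent :: "nat \<Rightarrow> real mat \<Rightarrow> bool" where
  "strictly_sign_consistent k X \<longleftrightarrow>
     (\<forall>I J. I \<subseteq> {..<dim_row X} \<and> J \<subseteq> {..<dim_col X} \<and> card I = k \<and> card J = k
        \<longrightarrow> det (submatrix X I J) > 0) \<or>
     (\<forall>I J. I \<subseteq> {..<dim_row X} \<and> J \<subseteq> {..<dim_col X} \<and> card I = k \<and> card J = k
        \<longrightarrow> det (submatrix X I J) < 0)"

text \<open>Only meant for lists without zero entries.\<close>

definition sign_changes :: "real list \<Rightarrow> nat" where
  "sign_changes xs = card {i. Suc i < length xs \<and> xs ! i * xs ! Suc i < 0}"

definition S_minus :: "real vec \<Rightarrow> int" where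
  "S_minus u = (if u = 0\<^sub>v (dim_vec u) then - 1
     else int (sign_changes (filter (\<lambda>x. x \<noteq> 0) (list_of_vec u))))"

definition zero_replacements :: "real vec \<Rightarrow> real vec set" where
  "zero_replacements u = {v \<in> carrier_vec (dim_vec u).
     \<forall>i<dim_vec u. v $ i \<noteq> 0 \<and> (u $ i \<noteq> 0 \<longrightarrow> v $ i = u $ i)}"

text \<open>No exception is made for the zero vector: in dimension \<open>n \<ge> 1\<close> it has
  \<open>S_plus\<close> equal to \<open>n - 1\<close>.\<close>

definition S_plus :: "real vec \<Rightarrow> nat" where
  "S_plus u = Max ((\<lambda>v. sign_changes (list_of_vec v)) ` zero_replacements u)"

text \<open>The maximum in the definition of \<open>S_plus\<close> is taken over a finite nonempty set.\<close>

lemma sign_changes_le_length: "sign_changes xs \<le> length xs"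
proof -
  have "card {i. Suc i < length xs \<and> xs ! i * xs ! Suc i < 0} \<le> card {..<length xs}"
    by (rule card_mono) auto
  then show ?thesis by (simp add: sign_changes_def)
qed

lemma finite_sign_changes_zero_replacements:
  "finite ((\<lambda>v. sign_changes (list_of_vec v)) ` zero_replacements u)"
proof (rule finite_subset)
  have "sign_changes (list_of_vec v) \<le> dim_vec u" if "v \<in> zero_replacements u" for v
    using sign_changes_le_length[of "list_of_vec v"] that by (auto simp: zero_replacements_def)
  then show "(\<lambda>v. sign_changes (list_of_vec v)) ` zero_replacements u \<subseteq> {..dim_vec u}"
    by blast
qed simp

lemma zero_replacements_nonempty: "zero_replacements u \<noteq> {}"
proof -
  have "vec (dim_vec u) (\<lambda>i. if u $ i = 0 then 1 else u $ i) \<in> zero_replacements u"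
    by (simp add: zero_replacements_def)
  then show ?thesis by blast
qed

definition strictly_variation_bounding :: "nat \<Rightarrow> real mat \<Rightarrow> bool" where
  "strictly_variation_bounding j X \<longleftrightarrow>
     (\<forall>u \<in> carrier_vec (dim_col X). u \<noteq> 0\<^sub>v (dim_col X) \<and> S_minus u \<le> int j
        \<longrightarrow> S_plus (X *\<^sub>v u) \<le> j)"

end

theory Submission
  imports Defs
begin

text \<open>
  Both properties are statements about alternating subsequences of length \<open>k + 1\<close>: \<open>S_minus u \<ge> k\<close> means
  that \<open>u\<close> has a strictly alternating subsequence of that length, and \<open>S_plus w \<ge> k\<close> that \<open>w\<close> has a weakly
  alternating one (\<open>le_S_minus_iff\<close>, \<open>le_S_plus_iff\<close>).

  Let all minors of order \<open>k\<close> have the same strict sign and let \<open>u \<noteq> 0\<close> have fewer than \<open>k\<close> sign changes.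
  The positions split into exactly \<open>k\<close> intervals on each of which \<open>u\<close> has weakly constant sign. Adding up
  the columns of each interval with the weights \<open>\<bar>u l\<bar>\<close> gives a matrix \<open>Y\<close> with \<open>k\<close> columns such that
  \<open>X u = Y d\<close> for a nonzero vector \<open>d\<close> of signs, where an interval on which \<open>u\<close> vanishes gets the sign 0
  and the weights 1; by multilinearity, the minors of \<open>Y\<close> have the sign of
  those of \<open>X\<close>. If \<open>Y d\<close> alternated weakly on \<open>k + 1\<close> rows, then in the Laplace expansion of the
  singular matrix \<open>(Y | Y d)\<close> on these rows all terms would have the same sign, so \<open>Y d\<close> would be zero
  there, contradicting the regularity of the square submatrices of \<open>Y\<close>
  (\<open>not_alternates_weakly_of_minors\<close>, \<open>sign_consistent_imp_bounding\<close>).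

  Conversely, let \<open>X\<close> be variation bounding. A singular submatrix of order \<open>k\<close> has a kernel vector,
  which extends to a vector \<open>u\<close> with at most \<open>k\<close> nonzero entries, hence fewer than \<open>k\<close> sign changes; but
  \<open>X u\<close> has \<open>k\<close> zeros and a further entry because \<open>k < n\<close>, so that \<open>S_plus (X u) \<ge> k\<close>. Therefore
  no minor vanishes. Any two selections of rows or columns are connected by moves of one index by 1 (\<open>increasing_induct\<close>), and such a move
  preserves the sign of the minor: for rows because the minors are themselves entries of a
  vector \<open>X u\<close> with \<open>u\<close> supported on \<open>k\<close> columns, for columns because by Cramer's rule they are, up to
  a common factor and alternating signs, the entries of a kernel vector on \<open>k + 1\<close> columns
  (\<open>bounding_imp_sign_consistent\<close>).
\<close>

section \<open>Sign changes as alternating subsequences\<close>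

text \<open>Sign changes of sequences are handled through subsequences with alternating signs: the
  strict form corresponds to \<open>S_minus\<close>, the weak one, where zeros may be given either sign, to
  \<open>S_plus\<close>. The number \<open>s\<close> carries the sign of the first entry.\<close>

definition alternates_strictly :: "nat \<Rightarrow> nat \<Rightarrow> (nat \<Rightarrow> real) \<Rightarrow> bool" where
  "alternates_strictly p n f \<longleftrightarrow>
     (\<exists>e s. strict_mono_on {..p} e \<and> e ` {..p} \<subseteq> {..<n} \<and> (\<forall>j\<le>p. 0 < s * (-1) ^ j * f (e j)))"

definition alternates_weakly :: "nat \<Rightarrow> nat \<Rightarrow> (nat \<Rightarrow> real) \<Rightarrow> bool" where
  "alternates_weakly p n f \<longleftrightarrow>
     (\<exists>e s. strict_mono_on {..p} e \<and> e ` {..p} \<subseteq> {..<n} \<and> s \<noteq> 0 \<and>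
        (\<forall>j\<le>p. 0 \<le> s * (-1) ^ j * f (e j)))"

lemma sign_changes_Cons_Cons:
  "sign_changes (x # y # zs) = (if x * y < 0 then 1 else 0) + sign_changes (y # zs)"
proof -
  let ?A = "\<lambda>xs. {i. Suc i < length xs \<and> xs ! i * xs ! Suc i < 0}"
  have "?A (x # y # zs) = (if x * y < 0 then {0} else {}) \<union> Suc ` ?A (y # zs)"
    (is "?L = ?R")
  proof (rule Set.set_eqI)
    fix i show "i \<in> ?L \<longleftrightarrow> i \<in> ?R" by (cases i) auto
  qed
  moreover have "finite (?A (y # zs))"
    by (rule finite_subset[of _ "{..<length (y # zs)}"]) auto
  ultimately show ?thesis
    by (simp add: sign_changes_def card_image)
qed

text \<open>The value \<open>b i\<close> counts the sign changes up to position \<open>i\<close>, where a zero is given the sign of the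
  next nonzero entry (and trailing zeros that of the last one). So the positions split into
  consecutive blocks of weakly constant sign, the sign alternates from block to block, and each
  block contains a nonzero entry. The last clause is what yields strictly alternating
  subsequences; the others yield the bound on their length and the grouping of columns.\<close>

lemma sign_blocks:
  fixes xs :: "real list"
  assumes "filter (\<lambda>x. x \<noteq> 0) xs \<noteq> []"
  shows "\<exists>b. b 0 = 0 \<and> (\<forall>i. b i \<le> b (Suc i) \<and> b (Suc i) \<le> Suc (b i)) \<and>
     (\<forall>i. b i \<le> sign_changes (filter (\<lambda>x. x \<noteq> 0) xs)) \<and>
     (\<forall>i<length xs. 0 \<le> hd (filter (\<lambda>x. x \<noteq> 0) xs) * (-1) ^ b i * xs ! i) \<and>
     (\<forall>j\<le>sign_changes (filter (\<lambda>x. x \<noteq> 0) xs). \<exists>i<length xs. b i = j \<and> xs ! i \<noteq> 0)"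
  using assms
proof (induction xs)
  case Nil
  then show ?case by simp
next
  case (Cons x ys)
  let ?F = "filter (\<lambda>x::real. x \<noteq> 0)"
  show ?case
  proof (cases "?F ys = []")
    case True
    with Cons.prems have "x \<noteq> 0" by auto
    have z: "ys ! i = 0" if "i < length ys" for i
      using True that by (auto simp: filter_empty_conv)
    show ?thesis
      using True \<open>x \<noteq> 0\<close>
      by (intro exI[of _ "\<lambda>_. 0"]) (auto simp: sign_changes_def nth_Cons z split: nat.split)
  next
    case False
    then obtain y zs where F: "?F ys = y # zs" by (cases "?F ys") auto
    have "y \<in> set (?F ys)" unfolding F by simp
    then have "y \<noteq> 0" by simp
    from Cons.IH[OF False] obtain b where b0: "b 0 = 0"
      and step: "\<And>i. b i \<le> b (Suc i) \<and> b (Suc i) \<le> Suc (b i)"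
      and le: "\<And>i. b i \<le> sign_changes (y # zs)"
      and sgn: "\<And>i. i < length ys \<Longrightarrow> 0 \<le> y * (-1) ^ b i * ys ! i"
      and ex: "\<And>j. j \<le> sign_changes (y # zs) \<Longrightarrow> \<exists>i<length ys. b i = j \<and> ys ! i \<noteq> 0"
      unfolding F by auto
    \<comment> \<open>A new block is opened in front exactly when the signs of \<open>x\<close> and of the next nonzero entry are opposite.\<close>
    define d :: nat where "d = (if x * y < 0 then 1 else 0)"
    define c where "c = case_nat 0 (\<lambda>i. b i + d)"
    let ?h = "if x = 0 then y else x"
    have hd: "hd (?F (x # ys)) = ?h" by (simp add: F)
    have sc: "sign_changes (?F (x # ys)) = sign_changes (y # zs) + d"
      by (auto simp: F sign_changes_Cons_Cons d_def)
    have sgn': "0 \<le> ?h * (-1) ^ (b i + d) * ys ! i" if "i < length ys" for i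
    proof -
      have *: "0 \<le> y * ((-1) ^ b i * ys ! i)" using sgn[OF that] by (simp add: mult.assoc)
      show ?thesis
      proof (cases "x * y < 0")
        case True
        then have "x * ((-1) ^ b i * ys ! i) \<le> 0" "x \<noteq> 0"
          using * by (auto simp: mult_less_0_iff zero_le_mult_iff mult_le_0_iff)
        then show ?thesis using True by (simp add: d_def mult.assoc)
      next
        case False
        then have "x \<noteq> 0 \<Longrightarrow> 0 \<le> x * ((-1) ^ b i * ys ! i)"
          using * \<open>y \<noteq> 0\<close> by (auto simp: mult_less_0_iff zero_le_mult_iff)
        then show ?thesis using False * by (simp add: d_def mult.assoc)
      qed
    qed
    have ex': "\<exists>i<length (x # ys). c i = j \<and> (x # ys) ! i \<noteq> 0"
      if j: "j \<le> sign_changes (y # zs) + d" for j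
    proof (cases "j < d")
      case True
      then show ?thesis by (intro exI[of _ 0]) (auto simp: c_def d_def split: if_splits)
    next
      case False
      then obtain i where "i < length ys" "b i = j - d" "ys ! i \<noteq> 0"
        using ex[of "j - d"] j by (auto simp: le_diff_conv)
      then show ?thesis using False by (intro exI[of _ "Suc i"]) (auto simp: c_def)
    qed
    have sgn0: "0 \<le> ?h * (-1) ^ c i * (x # ys) ! i" if "i < length (x # ys)" for i
    proof (cases i)
      case 0
      then show ?thesis by (simp add: c_def)
    next
      case (Suc l)
      then show ?thesis using sgn'[of l] that by (simp add: c_def)
    qed
    show ?thesis
      unfolding hd sc
    proof (intro exI[of _ c] conjI allI impI)
      fix i
      show "c i \<le> c (Suc i)" "c (Suc i) \<le> Suc (c i)"
        using step b0 by (auto simp: c_def d_def split: nat.split)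
      show "c i \<le> sign_changes (y # zs) + d"
        using le by (auto simp: c_def split: nat.split)
    qed (use sgn0 ex' in \<open>simp_all add: c_def\<close>)
  qed
qed

text \<open>One entry from each sign block gives an alternating subsequence. Conversely, consecutive members
  of an alternating subsequence have opposite signs, hence lie in different blocks.\<close>

lemma sign_changes_iff_alternates_strictly:
  assumes "filter (\<lambda>x. x \<noteq> 0) xs \<noteq> []"
  shows "p \<le> sign_changes (filter (\<lambda>x. x \<noteq> 0) xs) \<longleftrightarrow> alternates_strictly p (length xs) ((!) xs)"
proof -
  let ?F = "filter (\<lambda>x::real. x \<noteq> 0) xs"
  obtain b where b0: "b 0 = 0" and step: "\<And>i. b i \<le> b (Suc i)"
    and le: "\<And>i. b i \<le> sign_changes ?F"
    and sgn: "\<And>i. i < length xs \<Longrightarrow> 0 \<le> hd ?F * (-1) ^ b i * xs ! i"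
    and ex: "\<And>j. j \<le> sign_changes ?F \<Longrightarrow> \<exists>i<length xs. b i = j \<and> xs ! i \<noteq> 0"
    using sign_blocks[OF assms] by metis
  have mono: "b i \<le> b i'" if "i \<le> i'" for i i' using that step by (rule lift_Suc_mono_le[rotated])
  have "hd ?F \<in> set ?F" using assms by (rule list.set_sel(1))
  then have h: "hd ?F \<noteq> 0" by simp
  show ?thesis
  proof
    assume p: "p \<le> sign_changes ?F"
    then have "\<forall>j\<in>{..p}. \<exists>i. i < length xs \<and> b i = j \<and> xs ! i \<noteq> 0" using ex by force
    from bchoice[OF this] obtain e
      where e: "\<And>j. j \<le> p \<Longrightarrow> e j < length xs \<and> b (e j) = j \<and> xs ! e j \<noteq> 0" by auto
    have "strict_mono_on {..p} e"
    proof (rule strict_mono_onI)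
      fix i j assume "i \<in> {..p}" "j \<in> {..p}" "i < j"
      then show "e i < e j" using e[of i] e[of j] mono[of "e j" "e i"] by force
    qed
    moreover have "0 < hd ?F * (-1) ^ j * xs ! e j" if "j \<le> p" for j
    proof -
      have "hd ?F * (-1) ^ j * xs ! e j \<noteq> 0" using e[OF that] h by (simp only: mult_eq_0_iff power_eq_0_iff) simp
      moreover have "0 \<le> hd ?F * (-1) ^ j * xs ! e j" using sgn[of "e j"] e[OF that] by simp
      ultimately show ?thesis by linarith
    qed
    ultimately show "alternates_strictly p (length xs) ((!) xs)"
      unfolding alternates_strictly_def using e by (intro exI[of _ e] exI[of _ "hd ?F"]) auto
  next
    assume "alternates_strictly p (length xs) ((!) xs)"
    then obtain e s where e: "strict_mono_on {..p} e" "\<And>j. j \<le> p \<Longrightarrow> e j < length xs"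
      and s: "\<And>j. j \<le> p \<Longrightarrow> 0 < s * (-1) ^ j * xs ! e j"
      unfolding alternates_strictly_def by (auto simp: image_subset_iff)
    have "j \<le> b (e j)" if "j \<le> p" for j
      using that
    proof (induction j)
      case (Suc j)
      have "e j < e (Suc j)" using e(1) Suc.prems by (simp add: strict_mono_on_def)
      then have m: "b (e j) \<le> b (e (Suc j))" by (intro mono) simp
      have "b (e j) \<noteq> b (e (Suc j))"
      proof
        assume eq: "b (e j) = b (e (Suc j))"
        define g t where "g = hd ?F * (-1) ^ b (e j)" and "t = s * (-1) ^ j"
        have "g \<noteq> 0" using h by (simp add: g_def)
        have "0 \<le> g * xs ! e j" "0 \<le> g * xs ! e (Suc j)"
          using sgn[of "e j"] sgn[of "e (Suc j)"] e(2) Suc.prems eq by (auto simp: g_def)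
        moreover have "0 < t * xs ! e j" "0 < - t * xs ! e (Suc j)"
          using s[of j] s[of "Suc j"] Suc.prems by (simp_all add: t_def)
        ultimately show False
          using \<open>g \<noteq> 0\<close> by (auto simp: zero_less_mult_iff zero_le_mult_iff mult_less_0_iff)
      qed
      with m Suc show ?case by simp
    qed simp
    from this[of p] show "p \<le> sign_changes ?F" using le[of "e p"] by simp
  qed
qed

lemma filter_nonzero_list_of_vec_eq_Nil_iff:
  "filter (\<lambda>x. x \<noteq> 0) (list_of_vec u) = [] \<longleftrightarrow> u = 0\<^sub>v (dim_vec u)"
proof -
  have "filter (\<lambda>x. x \<noteq> 0) (list_of_vec u) = [] \<longleftrightarrow> (\<forall>i<dim_vec u. u $ i = 0)"
    by (simp add: filter_empty_conv all_set_conv_all_nth list_of_vec_index length_list_of_vec)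
  then show ?thesis by (auto simp: vec_eq_iff)
qed

lemma alternates_strictly_cong:
  "n = n' \<Longrightarrow> (\<And>i. i < n' \<Longrightarrow> f i = g i) \<Longrightarrow> alternates_strictly p n f \<longleftrightarrow> alternates_strictly p n' g"
  unfolding alternates_strictly_def by (intro ex_cong1 conj_cong refl) (auto simp: image_subset_iff)

lemma alternates_weakly_cong:
  "n = n' \<Longrightarrow> (\<And>i. i < n' \<Longrightarrow> f i = g i) \<Longrightarrow> alternates_weakly p n f \<longleftrightarrow> alternates_weakly p n' g"
  unfolding alternates_weakly_def by (intro ex_cong1 conj_cong refl) (auto simp: image_subset_iff)

lemma le_S_minus_iff:
  assumes "u \<noteq> 0\<^sub>v (dim_vec u)"
  shows "int p \<le> S_minus u \<longleftrightarrow> alternates_strictly p (dim_vec u) (($) u)"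
  using assms sign_changes_iff_alternates_strictly[of "list_of_vec u" p]
  by (simp add: S_minus_def filter_nonzero_list_of_vec_eq_Nil_iff list_of_vec_index length_list_of_vec
      cong: alternates_strictly_cong)

text \<open>A replacement of the zeros that attains many sign changes restricts to a weakly alternating
  subsequence. Conversely, along a weakly alternating subsequence the zeros can be filled in so that
  the signs alternate strictly. A vector of dimension 0 has to be excluded: its \<open>S_plus\<close> is 0,
  although it has no subsequence of length 1.\<close>

lemma le_S_plus_iff:
  assumes "dim_vec w > 0"
  shows "p \<le> S_plus w \<longleftrightarrow> alternates_weakly p (dim_vec w) (($) w)"
proof -
  have *: "p \<le> sign_changes (list_of_vec v) \<longleftrightarrow> alternates_strictly p (dim_vec w) (($) v)"
    if "v \<in> zero_replacements w" for v
  proof -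
    have v: "dim_vec v = dim_vec w" "\<And>i. i < dim_vec w \<Longrightarrow> v $ i \<noteq> 0"
      using that by (auto simp: zero_replacements_def)
    have "filter (\<lambda>x. x \<noteq> 0) (list_of_vec v) = list_of_vec v"
      using v by (auto simp: filter_id_conv in_set_conv_nth list_of_vec_index)
    moreover have "list_of_vec v \<noteq> []"
      using v assms by (metis length_greater_0_conv length_list_of_vec)
    ultimately show ?thesis
      using sign_changes_iff_alternates_strictly[of "list_of_vec v" p] v(1)
      by (simp add: list_of_vec_index length_list_of_vec cong: alternates_strictly_cong)
  qed
  have "p \<le> S_plus w \<longleftrightarrow> (\<exists>v\<in>zero_replacements w. p \<le> sign_changes (list_of_vec v))"
    unfolding S_plus_def
    using finite_sign_changes_zero_replacements[of w] zero_replacements_nonempty[of w]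
    by (subst Max_ge_iff) auto
  also have "\<dots> \<longleftrightarrow> (\<exists>v\<in>zero_replacements w. alternates_strictly p (dim_vec w) (($) v))"
    using * by blast
  also have "\<dots> \<longleftrightarrow> alternates_weakly p (dim_vec w) (($) w)"
  proof
    assume "\<exists>v\<in>zero_replacements w. alternates_strictly p (dim_vec w) (($) v)"
    then obtain v e s where v: "v \<in> zero_replacements w"
      and e: "strict_mono_on {..p} e" "e ` {..p} \<subseteq> {..<dim_vec w}"
      and s: "\<And>j. j \<le> p \<Longrightarrow> 0 < s * (-1) ^ j * v $ e j"
      unfolding alternates_strictly_def by blast
    have "s \<noteq> 0" using s[of 0] by auto
    moreover have "0 \<le> s * (-1) ^ j * w $ e j" if "j \<le> p" for j
      using v s[OF that] e(2) that
      by (cases "w $ e j = 0") (auto simp: zero_replacements_def image_subset_iff less_imp_le)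
    ultimately show "alternates_weakly p (dim_vec w) (($) w)"
      unfolding alternates_weakly_def using e by blast
  next
    assume "alternates_weakly p (dim_vec w) (($) w)"
    then obtain e s where e: "strict_mono_on {..p} e" "e ` {..p} \<subseteq> {..<dim_vec w}" "s \<noteq> 0"
      and s: "\<And>j. j \<le> p \<Longrightarrow> 0 \<le> s * (-1) ^ j * w $ e j"
      unfolding alternates_weakly_def by blast
    have inj: "inj_on e {..p}" using e(1) by (rule strict_mono_on_imp_inj_on)
    \<comment> \<open>Zeros off the subsequence may be replaced by anything; 1 is used.\<close>
  define f where "f i = (if w $ i \<noteq> 0 then w $ i
      else if i \<in> e ` {..p} then s * (-1) ^ the_inv_into {..p} e i else 1)" for i
    have "vec (dim_vec w) f \<in> zero_replacements w"
      using e(3) by (auto simp: zero_replacements_def f_def)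
    moreover have "0 < s * (-1) ^ j * vec (dim_vec w) f $ e j" if j: "j \<le> p" for j
    proof -
      have "e j < dim_vec w" using e(2) j by auto
      moreover have "the_inv_into {..p} e (e j) = j" using inj j by (simp add: the_inv_into_f_f)
      moreover define t where "t = s * (-1) ^ j"
      moreover have "t \<noteq> 0" using e(3) by (simp add: t_def)
      then have "0 < t * t" "w $ e j \<noteq> 0 \<Longrightarrow> 0 < t * w $ e j"
        using s[OF j] by (auto simp: t_def[symmetric] zero_less_mult_iff zero_le_mult_iff)
      ultimately show ?thesis using j by (auto simp: f_def)
    qed
    ultimately show "\<exists>v\<in>zero_replacements w. alternates_strictly p (dim_vec w) (($) v)"
      unfolding alternates_strictly_def using e(1,2) by blast
  qed
  finally show ?thesis .
qed

section \<open>Minors along increasing selections of rows and columns\<close>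

text \<open>Rows and columns are selected by functions instead of sets, so that a single index can be
  replaced by function update; entries come from a function, so that matrices with columns formed
  from those of another one need no extra dimensions.\<close>

definition minor :: "nat \<Rightarrow> (nat \<Rightarrow> nat \<Rightarrow> 'a::comm_ring_1) \<Rightarrow> (nat \<Rightarrow> nat) \<Rightarrow> (nat \<Rightarrow> nat) \<Rightarrow> 'a" where
  "minor k A r c = det (mat k k (\<lambda>(i, j). A (r i) (c j)))"

definition increasing :: "nat \<Rightarrow> nat \<Rightarrow> (nat \<Rightarrow> nat) \<Rightarrow> bool" where
  "increasing k n r \<longleftrightarrow> strict_mono_on {..<k} r \<and> r ` {..<k} \<subseteq> {..<n}"

lemma increasingD:
  assumes "increasing k n r"
  shows "i < j \<Longrightarrow> j < k \<Longrightarrow> r i < r j" "i < k \<Longrightarrow> r i < n" "inj_on r {..<k}"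
  using assms strict_mono_on_imp_inj_on
  by (auto simp: increasing_def image_subset_iff intro: strict_mono_onD)

lemma minor_cong:
  "(\<And>i. i < k \<Longrightarrow> r i = r' i) \<Longrightarrow> (\<And>j. j < k \<Longrightarrow> c j = c' j) \<Longrightarrow> minor k A r c = minor k A r' c'"
  unfolding minor_def by (intro arg_cong[of _ _ det] eq_matI) auto

lemma increasing_pick:
  assumes "I \<subseteq> {..<n}" "card I = k"
  shows "increasing k n (pick I)"
  unfolding increasing_def using assms pick_mono_le[of _ I] pick_in_set_le[of _ I]
  by (auto intro!: strict_mono_onI)

lemma pick_image:
  assumes "strict_mono_on {..<k} r" "i < k"
  shows "pick (r ` {..<k}) i = r i"
proof -
  have "{a \<in> r ` {..<k}. a < r i} = r ` {..<i}"
    using assms strict_mono_on_less[OF assms(1)] by auto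
  moreover have "inj_on r {..<i}"
    using strict_mono_on_imp_inj_on[OF assms(1)] assms(2) by (auto intro: inj_on_subset)
  ultimately have "card {a \<in> r ` {..<k}. a < r i} = i" by (simp add: card_image)
  then show ?thesis using pick_card_in_set[of "r i" "r ` {..<k}"] assms(2) by auto
qed

text \<open>Sets of \<open>k\<close> indices correspond to increasing selections through \<open>pick\<close>. The two alternatives of
  the definition are merged into one sign factor \<open>s\<close>.\<close>

lemma strictly_sign_consistent_iff_minor:
  assumes "X \<in> carrier_mat n m"
  shows "strictly_sign_consistent k X \<longleftrightarrow>
    (\<exists>s. \<forall>r c. increasing k n r \<longrightarrow> increasing k m c \<longrightarrow> 0 < s * minor k (\<lambda>i j. X $$ (i, j)) r c)"
    (is "_ \<longleftrightarrow> (\<exists>s. ?P s)")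
proof -
  have sub: "det (submatrix X I J) = minor k (\<lambda>i j. X $$ (i, j)) (pick I) (pick J)"
    if "I \<subseteq> {..<n}" "J \<subseteq> {..<m}" "card I = k" "card J = k" for I J
  proof -
    have "{i. i < n \<and> i \<in> I} = I" "{j. j < m \<and> j \<in> J} = J" using that by auto
    then show ?thesis using assms that by (simp add: submatrix_def minor_def)
  qed
  have eq: "(\<forall>I J. I \<subseteq> {..<n} \<and> J \<subseteq> {..<m} \<and> card I = k \<and> card J = k \<longrightarrow> Q (det (submatrix X I J)))
    \<longleftrightarrow> (\<forall>r c. increasing k n r \<longrightarrow> increasing k m c \<longrightarrow> Q (minor k (\<lambda>i j. X $$ (i, j)) r c))" for Q
  proof (intro iffI allI impI)
    fix r c
    assume Q: "\<forall>I J. I \<subseteq> {..<n} \<and> J \<subseteq> {..<m} \<and> card I = k \<and> card J = k \<longrightarrow> Q (det (submatrix X I J))"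
      and r: "increasing k n r" and c: "increasing k m c"
    let ?I = "r ` {..<k}" and ?J = "c ` {..<k}"
    have IJ: "?I \<subseteq> {..<n}" "?J \<subseteq> {..<m}" "card ?I = k" "card ?J = k"
      using r c increasingD(3)[OF r] increasingD(3)[OF c] by (simp_all add: increasing_def card_image)
    have "minor k (\<lambda>i j. X $$ (i, j)) (pick ?I) (pick ?J) = minor k (\<lambda>i j. X $$ (i, j)) r c"
      using r c by (intro minor_cong) (simp_all add: pick_image increasing_def)
    then show "Q (minor k (\<lambda>i j. X $$ (i, j)) r c)" using Q IJ sub[OF IJ] by metis
  next
    fix I J
    assume "\<forall>r c. increasing k n r \<longrightarrow> increasing k m c \<longrightarrow> Q (minor k (\<lambda>i j. X $$ (i, j)) r c)"
      and "I \<subseteq> {..<n} \<and> J \<subseteq> {..<m} \<and> card I = k \<and> card J = k"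
    then show "Q (det (submatrix X I J))" using sub[of I J] increasing_pick by simp
  qed
  have "strictly_sign_consistent k X \<longleftrightarrow> ?P 1 \<or> ?P (- 1)"
    using assms eq[of "\<lambda>x. 0 < x"] eq[of "\<lambda>x. x < 0"] by (simp add: strictly_sign_consistent_def)
  also have "\<dots> \<longleftrightarrow> (\<exists>s. ?P s)"
  proof (intro iffI)
    assume "\<exists>s. ?P s"
    then obtain s where s: "?P s" ..
    show "?P 1 \<or> ?P (- 1)"
    proof (cases "s > 0")
      case True
      then show ?thesis using s by (simp add: zero_less_mult_iff)
    next
      case False
      then show ?thesis using s by (auto simp: zero_less_mult_iff)
    qed
  qed blast
  finally show ?thesis .
qed

text \<open>For integers, being at most \<open>k - 1\<close> means not being at least \<open>k\<close>; so both sides of the bound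
  become statements about alternating subsequences of length \<open>k + 1\<close>.\<close>

lemma strictly_variation_bounding_iff_alternates:
  assumes X: "X \<in> carrier_mat n m" and "1 \<le> k" "0 < n"
  shows "strictly_variation_bounding (k - 1) X \<longleftrightarrow>
    (\<forall>u. (\<exists>l<m. u l \<noteq> 0) \<longrightarrow> \<not> alternates_strictly k m u \<longrightarrow>
       \<not> alternates_weakly k n (\<lambda>i. \<Sum>l<m. X $$ (i, l) * u l))"
    (is "_ \<longleftrightarrow> (\<forall>u. ?R u)")
proof -
  have mult: "(X *\<^sub>v vec m u) $ i = (\<Sum>l<m. X $$ (i, l) * u l)" if "i < n" for i u
    using X that by (auto simp: scalar_prod_def atLeast0LessThan intro!: sum.cong)
  have key: "(vec m u \<noteq> 0\<^sub>v m \<and> S_minus (vec m u) \<le> int (k - 1) \<longrightarrow> S_plus (X *\<^sub>v vec m u) \<le> k - 1) \<longleftrightarrow> ?R u"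
    for u :: "nat \<Rightarrow> real"
  proof (cases "vec m u = 0\<^sub>v m")
    case True
    then have "u l = 0" if "l < m" for l using that by (metis index_vec index_zero_vec(1))
    then show ?thesis using True by auto
  next
    case False
    then have u: "\<exists>l<m. u l \<noteq> 0" by (auto simp: vec_eq_iff)
    have "S_minus (vec m u) \<le> int (k - 1) \<longleftrightarrow> \<not> int k \<le> S_minus (vec m u)"
      using \<open>1 \<le> k\<close> by auto
    also have "\<dots> \<longleftrightarrow> \<not> alternates_strictly k m u"
      using False by (subst le_S_minus_iff) (auto cong: alternates_strictly_cong)
    finally have "S_minus (vec m u) \<le> int (k - 1) \<longleftrightarrow> \<not> alternates_strictly k m u" .
    moreover have "S_plus (X *\<^sub>v vec m u) \<le> k - 1 \<longleftrightarrow> \<not> k \<le> S_plus (X *\<^sub>v vec m u)"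
      using \<open>1 \<le> k\<close> by auto
    moreover have "k \<le> S_plus (X *\<^sub>v vec m u) \<longleftrightarrow>
        alternates_weakly k n (($) (X *\<^sub>v vec m u))"
      using X \<open>0 < n\<close> by (subst le_S_plus_iff) auto
    moreover have "alternates_weakly k n (($) (X *\<^sub>v vec m u)) \<longleftrightarrow>
        alternates_weakly k n (\<lambda>i. \<Sum>l<m. X $$ (i, l) * u l)"
      using mult[of _ u] by (intro alternates_weakly_cong) auto
    ultimately show ?thesis using False u by simp
  qed
  have "strictly_variation_bounding (k - 1) X \<longleftrightarrow>
    (\<forall>v\<in>carrier_vec m. v \<noteq> 0\<^sub>v m \<and> S_minus v \<le> int (k - 1) \<longrightarrow> S_plus (X *\<^sub>v v) \<le> k - 1)"
    using X by (simp add: strictly_variation_bounding_def)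
  also have "\<dots> \<longleftrightarrow> (\<forall>u. vec m u \<noteq> 0\<^sub>v m \<and> S_minus (vec m u) \<le> int (k - 1) \<longrightarrow>
      S_plus (X *\<^sub>v vec m u) \<le> k - 1)" (is "?a \<longleftrightarrow> ?b")
  proof
    assume b: ?b
    show ?a
    proof
      fix v :: "real vec" assume "v \<in> carrier_vec m"
      then have "v = vec m (($) v)" by (intro eq_vecI) auto
      with b show "v \<noteq> 0\<^sub>v m \<and> S_minus v \<le> int (k - 1) \<longrightarrow> S_plus (X *\<^sub>v v) \<le> k - 1"
        by metis
    qed
  qed auto
  also have "\<dots> \<longleftrightarrow> (\<forall>u. ?R u)" using key by blast
  finally show ?thesis .
qed

section \<open>Matrices with few columns\<close>

text \<open>Multilinearity of the determinant in its columns, obtained by expanding the products in the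
  Leibniz formula.\<close>

lemma minor_sum_columns:
  assumes "\<And>q. q < k \<Longrightarrow> finite (B q)"
  shows "minor k (\<lambda>i q. \<Sum>l\<in>B q. a l * A i l) r id =
    (\<Sum>f\<in>Pi\<^sub>E {..<k} B. (\<Prod>q<k. a (f q)) * minor k A r f)"
proof -
  let ?S = "{p. p permutes {0..<k}}"
  have lt: "p j < k" if "p permutes {0..<k}" "j < k" for p j
    using that permutes_in_image[OF that(1), of j] by simp
  have "minor k (\<lambda>i q. \<Sum>l\<in>B q. a l * A i l) r id =
    (\<Sum>p\<in>?S. signof p * (\<Prod>j<k. \<Sum>l\<in>B j. a l * A (r (p j)) l))"
    unfolding minor_def by (subst det_col[of _ k]) (auto intro!: sum.cong prod.cong simp: lt)
  also have "\<dots> = (\<Sum>p\<in>?S. signof p * (\<Sum>f\<in>Pi\<^sub>E {..<k} B. \<Prod>j<k. a (f j) * A (r (p j)) (f j)))"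
    using assms by (intro sum.cong refl arg_cong2[of _ _ _ _ "(*)"] prod_sum_PiE) auto
  also have "\<dots> = (\<Sum>f\<in>Pi\<^sub>E {..<k} B. \<Sum>p\<in>?S. signof p * (\<Prod>j<k. a (f j) * A (r (p j)) (f j)))"
    unfolding sum_distrib_left by (rule sum.swap)
  also have "\<dots> = (\<Sum>f\<in>Pi\<^sub>E {..<k} B. (\<Prod>q<k. a (f q)) *
      (\<Sum>p\<in>?S. signof p * (\<Prod>j<k. A (r (p j)) (f j))))"
    by (simp add: prod.distrib sum_distrib_left ac_simps)
  also have "\<dots> = (\<Sum>f\<in>Pi\<^sub>E {..<k} B. (\<Prod>q<k. a (f q)) * minor k A r f)"
    unfolding minor_def
    by (intro sum.cong refl arg_cong2[of _ _ _ _ "(*)"], subst det_col[of _ k])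
      (auto intro!: sum.cong prod.cong simp: lt)
  finally show ?thesis .
qed

text \<open>If each column of a new matrix is a nonnegative combination of one block of consecutive columns of
  \<open>A\<close>, then every selection of one column per block is increasing. The minors of the new
  matrix are therefore nonnegative combinations of minors of \<open>A\<close> and inherit their sign; some coefficient
  is positive as soon as every block has a positive weight.\<close>

lemma minor_sum_blocks_pos:
  fixes A :: "nat \<Rightarrow> nat \<Rightarrow> real"
  assumes A: "\<And>c. increasing k m c \<Longrightarrow> 0 < s * minor k A r c"
    and b: "mono b" and a: "\<And>l. l < m \<Longrightarrow> 0 \<le> a l"
    and ex: "\<And>q. q < k \<Longrightarrow> \<exists>l<m. b l = q \<and> 0 < a l"
  shows "0 < s * minor k (\<lambda>i q. \<Sum>l | l < m \<and> b l = q. a l * A i l) r id"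
proof -
  let ?B = "\<lambda>q. {l. l < m \<and> b l = q}"
  let ?E = "Pi\<^sub>E {..<k} ?B"
  have fin: "finite ?E" by (rule finite_PiE) auto
  have inc: "increasing k m f" if "f \<in> ?E" for f
    unfolding increasing_def
  proof
    have f: "f q < m" "b (f q) = q" if "q < k" for q using \<open>f \<in> ?E\<close> that by (auto simp: PiE_iff)
    show "strict_mono_on {..<k} f"
    proof (rule strict_mono_onI)
      fix p q assume "p \<in> {..<k}" "q \<in> {..<k}" "p < q"
      then show "f p < f q" using f[of p] f[of q] monoD[OF b, of "f q" "f p"] by force
    qed
    show "f ` {..<k} \<subseteq> {..<m}" using f by auto
  qed
  have nonneg: "0 \<le> (\<Prod>q<k. a (f q))" if "f \<in> ?E" for f
    using that a by (intro prod_nonneg) (auto simp: PiE_iff)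
  have "\<forall>q\<in>{..<k}. \<exists>l. l < m \<and> b l = q \<and> 0 < a l" using ex by auto
  from bchoice[OF this] obtain g
    where g: "\<And>q. q < k \<Longrightarrow> g q < m \<and> b (g q) = q \<and> 0 < a (g q)" by auto
  let ?g = "restrict g {..<k}"
  have gE: "?g \<in> ?E" using g by auto
  have "0 < (\<Prod>q<k. a (?g q))" using g by (intro prod_pos) auto
  then have pos: "0 < (\<Prod>q<k. a (?g q)) * (s * minor k A r ?g)"
    using A[OF inc[OF gE]] by simp
  have "0 < (\<Sum>f\<in>?E. (\<Prod>q<k. a (f q)) * (s * minor k A r f))"
  proof (rule sum_pos2[OF fin gE])
    show "0 < (\<Prod>q<k. a (?g q)) * (s * minor k A r ?g)" by (rule pos)
  next
    fix f assume f: "f \<in> ?E"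
    show "0 \<le> (\<Prod>q<k. a (f q)) * (s * minor k A r f)"
      by (rule mult_nonneg_nonneg[OF nonneg[OF f] less_imp_le[OF A[OF inc[OF f]]]])
  qed
  also have "\<dots> = s * minor k (\<lambda>i q. \<Sum>l\<in>?B q. a l * A i l) r id"
    by (subst minor_sum_columns) (auto simp: sum_distrib_left ac_simps)
  finally show ?thesis .
qed

text \<open>Singularity in terms of functions, so that kernel elements need not be converted to vectors.\<close>

lemma minor_eq_0_iff_kernel:
  fixes A :: "nat \<Rightarrow> nat \<Rightarrow> real"
  shows "minor k A r c = 0 \<longleftrightarrow>
    (\<exists>x. (\<exists>q<k. x q \<noteq> 0) \<and> (\<forall>p<k. (\<Sum>q<k. A (r p) (c q) * x q) = 0))"
proof -
  let ?M = "mat k k (\<lambda>(i, j). A (r i) (c j))"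
  have row: "(?M *\<^sub>v v) $ p = (\<Sum>q<k. A (r p) (c q) * v $ q)"
    if "v \<in> carrier_vec k" "p < k" for v p
    using that by (auto simp: scalar_prod_def atLeast0LessThan intro!: sum.cong)
  have "minor k A r c = 0 \<longleftrightarrow> (\<exists>v. v \<in> carrier_vec k \<and> v \<noteq> 0\<^sub>v k \<and> ?M *\<^sub>v v = 0\<^sub>v k)"
    unfolding minor_def by (rule det_0_iff_vec_prod_zero) auto
  also have "\<dots> \<longleftrightarrow> (\<exists>x. (\<exists>q<k. x q \<noteq> 0) \<and> (\<forall>p<k. (\<Sum>q<k. A (r p) (c q) * x q) = 0))"
  proof
    assume "\<exists>v. v \<in> carrier_vec k \<and> v \<noteq> 0\<^sub>v k \<and> ?M *\<^sub>v v = 0\<^sub>v k"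
    then obtain v where v: "v \<in> carrier_vec k" "v \<noteq> 0\<^sub>v k" "?M *\<^sub>v v = 0\<^sub>v k" by blast
    have "\<exists>q<k. v $ q \<noteq> 0" using v(1,2) by (auto simp: vec_eq_iff)
    moreover have "(\<Sum>q<k. A (r p) (c q) * v $ q) = 0" if "p < k" for p
      using row[OF v(1) that] v(3) that by simp
    ultimately show "\<exists>x. (\<exists>q<k. x q \<noteq> 0) \<and> (\<forall>p<k. (\<Sum>q<k. A (r p) (c q) * x q) = 0)" by blast
  next
    assume "\<exists>x. (\<exists>q<k. x q \<noteq> 0) \<and> (\<forall>p<k. (\<Sum>q<k. A (r p) (c q) * x q) = 0)"
    then obtain x q where x: "q < k" "x q \<noteq> 0" "\<And>p. p < k \<Longrightarrow> (\<Sum>q<k. A (r p) (c q) * x q) = 0"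
      by blast
    have "vec k x \<noteq> 0\<^sub>v k" using x(1,2) by (metis index_vec index_zero_vec(1))
    moreover have "?M *\<^sub>v vec k x = 0\<^sub>v k"
      using row[of "vec k x"] x(3) by (intro eq_vecI) (auto simp del: index_mult_mat_vec)
    ultimately show "\<exists>v. v \<in> carrier_vec k \<and> v \<noteq> 0\<^sub>v k \<and> ?M *\<^sub>v v = 0\<^sub>v k" by (intro exI[of _ "vec k x"]) simp
  qed
  finally show ?thesis .
qed

text \<open>Border \<open>k + 1\<close> rows of \<open>Y\<close> by the entries of \<open>w = Y d\<close>. The bordered determinant vanishes. If \<open>w\<close> alternates
  weakly along these rows, all terms of the Laplace expansion along the last column have the same
  sign: the cofactor signs alternate and the minors of \<open>Y\<close> do not change sign. So each term is zero,
  hence \<open>w\<close> vanishes on these rows. But then \<open>d\<close> is in the kernel of a nonsingular square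
  matrix.\<close>

lemma not_alternates_weakly_of_minors:
  fixes Y :: "nat \<Rightarrow> nat \<Rightarrow> real"
  assumes Y: "\<And>r. increasing k n r \<Longrightarrow> 0 < s * minor k Y r id"
    and d: "q0 < k" "d q0 \<noteq> 0"
  shows "\<not> alternates_weakly k n (\<lambda>i. \<Sum>q<k. Y i q * d q)"
proof
  define w where "w i = (\<Sum>q<k. Y i q * d q)" for i
  assume "alternates_weakly k n (\<lambda>i. \<Sum>q<k. Y i q * d q)"
  then obtain e t where e: "strict_mono_on {..k} e" "\<And>j. j \<le> k \<Longrightarrow> e j < n" and "t \<noteq> 0"
    and t: "\<And>j. j \<le> k \<Longrightarrow> 0 \<le> t * (-1) ^ j * w (e j)"
    unfolding alternates_weakly_def w_def by (auto simp: image_subset_iff)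
  \<comment> \<open>Column \<open>k\<close> of \<open>Z\<close> is \<open>w\<close>, and \<open>skip p\<close> enumerates the row numbers other than \<open>p\<close>.\<close>
  define Z where "Z i q = (if q < k then Y i q else w i)" for i q
  define skip where "skip p i = (if i < p then i else Suc i)" for p i :: nat
  have inc: "increasing k n (\<lambda>i. e (skip p i))" if "p \<le> k" for p
    unfolding increasing_def
  proof
    show "strict_mono_on {..<k} (\<lambda>i. e (skip p i))"
      using that by (intro strict_mono_onI strict_mono_onD[OF e(1)]) (auto simp: skip_def)
    show "(\<lambda>i. e (skip p i)) ` {..<k} \<subseteq> {..<n}"
      using that by (auto simp: skip_def intro!: e(2))
  qed
  have "minor (Suc k) Z e id = 0"
    unfolding minor_eq_0_iff_kernel
    by (rule exI[of _ "\<lambda>q. if q < k then d q else - 1"])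
      (use d in \<open>auto simp: Z_def w_def intro!: exI[of _ q0]\<close>)
  moreover have "minor (Suc k) Z e id =
      (\<Sum>p<Suc k. w (e p) * ((-1) ^ (p + k) * minor k Y (\<lambda>i. e (skip p i)) id))"
    unfolding minor_def
  proof (subst laplace_expansion_column[of _ "Suc k" k], simp, simp, intro sum.cong refl)
    fix p assume p: "p \<in> {..<Suc k}"
    let ?M = "mat (Suc k) (Suc k) (\<lambda>(i, j). Z (e i) (id j))"
    have "mat_delete ?M p k = mat k k (\<lambda>(i, j). Y (e (skip p i)) (id j))"
      using p by (intro eq_matI) (auto simp: mat_delete_def Z_def skip_def)
    then show "?M $$ (p, k) * cofactor ?M p k =
        w (e p) * ((-1) ^ (p + k) * det (mat k k (\<lambda>(i, j). Y (e (skip p i)) (id j))))"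
      using p by (simp add: cofactor_def Z_def)
  qed
  ultimately have "(\<Sum>p<Suc k. w (e p) * ((-1) ^ (p + k) * minor k Y (\<lambda>i. e (skip p i)) id)) = 0"
    by simp
  then have "s * t * (-1) ^ k *
      (\<Sum>p<Suc k. w (e p) * ((-1) ^ (p + k) * minor k Y (\<lambda>i. e (skip p i)) id)) = 0" by simp
  then have sum0: "(\<Sum>p<Suc k. (t * (-1) ^ p * w (e p)) * (s * minor k Y (\<lambda>i. e (skip p i)) id)) = 0"
    by (simp add: sum_distrib_left power_add ac_simps del: sum.lessThan_Suc)
  have w0: "w (e p) = 0" if "p \<le> k" for p
  proof -
    have "(t * (-1) ^ p * w (e p)) * (s * minor k Y (\<lambda>i. e (skip p i)) id) = 0"
    proof (rule sum_nonneg_0[OF _ _ sum0])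
      fix p assume "p \<in> {..<Suc k}"
      then have "p \<le> k" by simp
      then show "0 \<le> (t * (-1) ^ p * w (e p)) * (s * minor k Y (\<lambda>i. e (skip p i)) id)"
        by (intro mult_nonneg_nonneg less_imp_le[OF Y[OF inc]] t)
    qed (use that in auto)
    then show ?thesis using Y[OF inc[OF that]] \<open>t \<noteq> 0\<close> by auto
  qed
  have "minor k Y (\<lambda>i. e (skip k i)) id = 0"
    unfolding minor_eq_0_iff_kernel
    using d w0 by (intro exI[of _ d]) (auto simp: w_def skip_def)
  then show False using Y[OF inc[of k]] by simp
qed

section \<open>From sign consistency to variation bounding\<close>

text \<open>The grouping argument needs exactly \<open>k\<close> blocks, while a vector may have fewer sign blocks.
  Blocks of a partition of \<open>m \<ge> k\<close> positions can be split further until there are \<open>k\<close> of them.\<close>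

lemma refinement_with_k_blocks:
  fixes b :: "nat \<Rightarrow> nat"
  assumes b0: "b 0 = 0" and step: "\<And>i. b i \<le> b (Suc i)" "\<And>i. b (Suc i) \<le> Suc (b i)"
    and lt: "\<And>i. b i < k" and "k \<le> m"
  obtains b' where "mono b'" "\<And>q. q < k \<Longrightarrow> \<exists>l<m. b' l = q"
    "\<And>l. l < m \<Longrightarrow> b' l < k" "\<And>l l'. b' l = b' l' \<Longrightarrow> b l = b l'"
proof
  \<comment> \<open>The line \<open>i - (m - k)\<close> reaches \<open>k - 1\<close> at the last position \<open>m - 1\<close>. Once it
    dominates \<open>b\<close>, every position is a block of its own; before that, the blocks are those of \<open>b\<close>.\<close>
  define b' where "b' i = max (b i) (i - (m - k))" for i
  have monob: "b i \<le> b i'" if "i \<le> i'" for i i' using that step(1) by (rule lift_Suc_mono_le[rotated])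
  have step': "b' (Suc i) \<le> Suc (b' i)" for i using step(2)[of i] by (auto simp: b'_def)
  show mono: "mono b'"
    unfolding b'_def by (intro monoI max.mono monob diff_le_mono)
  have "0 < k" using lt[of 0] by simp
  have last: "b' (m - 1) = k - 1" and "b' 0 = 0"
    using lt[of "m - 1"] \<open>0 < k\<close> \<open>k \<le> m\<close> b0 by (auto simp: b'_def max_def)
  show "b' l < k" if "l < m" for l
    using that lt[of l] \<open>k \<le> m\<close> by (auto simp: b'_def)
  have hit: "\<exists>l\<le>i. b' l = q" if "q \<le> b' i" for q i
    using that
  proof (induction i)
    case 0
    then show ?case using \<open>b' 0 = 0\<close> by auto
  next
    case (Suc i)
    then show ?case using step'[of i] by (cases "q \<le> b' i") (auto intro: le_SucI simp: not_le)
  qed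
  show "\<exists>l<m. b' l = q" if "q < k" for q
  proof -
    have "q \<le> b' (m - 1)" using last that by simp
    from hit[OF this] obtain l where "l \<le> m - 1" "b' l = q" by blast
    then show ?thesis using \<open>0 < k\<close> \<open>k \<le> m\<close> by (intro exI[of _ l]) auto
  qed
  have le: "b l = b l'" if eq: "b' l = b' l'" and ll: "l < l'" for l l'
  proof -
    have "b' l' = b l'"
    proof (rule ccontr)
      assume ne: "b' l' \<noteq> b l'"
      then have "b l' < l' - (m - k)" by (auto simp: b'_def max_def split: if_splits)
      then have "b' l < b' l'"
        using monob[of l l'] ll by (auto simp: b'_def)
      with eq show False by simp
    qed
    moreover have "b' l = b l"
    proof (rule ccontr)
      assume "b' l \<noteq> b l"
      then have "b' l = l - (m - k)" "0 < l - (m - k)" by (auto simp: b'_def max_def split: if_splits)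
      moreover from this have "l - (m - k) < l' - (m - k)" using ll by linarith
      ultimately have "b' l < b' l'" by (simp add: b'_def less_max_iff_disj)
      with eq show False by simp
    qed
    ultimately show ?thesis using eq by simp
  qed
  show "b l = b l'" if "b' l = b' l'" for l l'
  proof (cases l l' rule: linorder_cases)
    case less
    then show ?thesis by (rule le[OF that])
  next
    case greater
    then show ?thesis by (rule le[OF that[symmetric], symmetric])
  qed simp
qed

text \<open>A vector with fewer than \<open>k\<close> sign changes has at most \<open>k\<close> sign blocks. Splitting them into exactly
  \<open>k\<close> keeps a constant sign \<open>e q\<close> on each block \<open>q\<close>.\<close>

lemma sign_blocks_exactly:
  fixes u :: "nat \<Rightarrow> real"
  assumes u: "\<exists>l<m. u l \<noteq> 0" and alt: "\<not> alternates_strictly k m u" and "k \<le> m"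
  obtains b e where "mono b" "\<And>q. q < k \<Longrightarrow> \<exists>l<m. b l = q" "\<And>l. l < m \<Longrightarrow> b l < k"
    "\<And>l. l < m \<Longrightarrow> u l = e (b l) * \<bar>u l\<bar>"
proof -
  let ?xs = "map u [0..<m]"
  let ?F = "filter (\<lambda>x. x \<noteq> 0) ?xs"
  have ne: "?F \<noteq> []" using u by (auto simp: filter_empty_conv)
  have "\<not> k \<le> sign_changes ?F"
    using alt sign_changes_iff_alternates_strictly[OF ne, of k] by (simp cong: alternates_strictly_cong)
  then have lt: "sign_changes ?F < k" by simp
  obtain b where b: "b 0 = 0" "\<And>i. b i \<le> b (Suc i)" "\<And>i. b (Suc i) \<le> Suc (b i)"
    and le: "\<And>i. b i \<le> sign_changes ?F"
    and sgn: "\<And>i. i < length ?xs \<Longrightarrow> 0 \<le> hd ?F * (-1) ^ b i * ?xs ! i"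
    using sign_blocks[OF ne] by blast
  have "b i < k" for i using le[of i] lt by simp
  from refinement_with_k_blocks[OF b this \<open>k \<le> m\<close>] obtain b'
    where b': "mono b'" "\<And>q. q < k \<Longrightarrow> \<exists>l<m. b' l = q" "\<And>l. l < m \<Longrightarrow> b' l < k"
      and ref: "\<And>l l'. b' l = b' l' \<Longrightarrow> b l = b l'" by blast
  define e where "e q = sgn (hd ?F) * (-1) ^ b (SOME l. b' l = q)" for q
  have "hd ?F \<in> set ?F" using ne by (rule list.set_sel(1))
  then have h: "hd ?F \<noteq> 0" by simp
  have sgn_abs: "y = sgn x * \<bar>y\<bar>" if "x \<noteq> 0" "0 \<le> x * y" for x y :: real
    using that by (cases "x > 0") (auto simp: zero_le_mult_iff)
  have eu: "u l = e (b' l) * \<bar>u l\<bar>" if "l < m" for l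
  proof -
    have "b' (SOME l'. b' l' = b' l) = b' l" by (rule someI) (rule refl)
    then have "b (SOME l'. b' l' = b' l) = b l" by (rule ref)
    then have "e (b' l) = sgn (hd ?F) * (-1) ^ b l" by (simp only: e_def)
    moreover have "0 \<le> hd ?F * ((-1) ^ b l * u l)" using sgn[of l] that by (simp add: mult.assoc)
    from sgn_abs[OF h this] have "u l = sgn (hd ?F) * (-1) ^ b l * \<bar>u l\<bar>"
      by (cases "even (b l)") simp_all
    ultimately show ?thesis by (simp only:)
  qed
  show ?thesis
  proof (rule that[of b' e])
    show "\<exists>l<m. b' l = q" if "q < k" for q using b'(2)[OF that] .
    show "b' l < k" if "l < m" for l using b'(3)[OF that] .
    show "u l = e (b' l) * \<bar>u l\<bar>" if "l < m" for l using eu[OF that] .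
  qed (rule b'(1))
qed

text \<open>Grouping the columns of \<open>A\<close> by the \<open>k\<close> sign blocks of \<open>u\<close>, with weights \<open>\<bar>u l\<bar>\<close>, gives a matrix \<open>Y\<close> with
  \<open>k\<close> columns whose minors have the sign of those of \<open>A\<close>, and \<open>A u = Y d\<close>, where \<open>d\<close> holds
  the signs of the blocks. This reduces the claim to matrices with \<open>k\<close> columns.\<close>

lemma sign_consistent_imp_bounding:
  fixes A :: "nat \<Rightarrow> nat \<Rightarrow> real"
  assumes A: "\<And>r c. increasing k n r \<Longrightarrow> increasing k m c \<Longrightarrow> 0 < s * minor k A r c"
    and "k \<le> m" and u: "\<exists>l<m. u l \<noteq> 0" and alt: "\<not> alternates_strictly k m u"
  shows "\<not> alternates_weakly k n (\<lambda>i. \<Sum>l<m. A i l * u l)"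
proof -
  obtain b e where b: "mono b" "\<And>q. q < k \<Longrightarrow> \<exists>l<m. b l = q" "\<And>l. l < m \<Longrightarrow> b l < k"
    and e: "\<And>l. l < m \<Longrightarrow> u l = e (b l) * \<bar>u l\<bar>"
    using sign_blocks_exactly[OF u alt \<open>k \<le> m\<close>] by blast
  \<comment> \<open>Blocks on which \<open>u\<close> vanishes get the weight 1 and the coefficient 0, since a zero column of \<open>Y\<close>
    would make its minors vanish.\<close>
  define active where "active q \<longleftrightarrow> (\<exists>l<m. b l = q \<and> u l \<noteq> 0)" for q
  define a where "a l = (if active (b l) then \<bar>u l\<bar> else 1)" for l
  define d where "d q = (if active q then e q else 0)" for q
  define Y where "Y i q = (\<Sum>l | l < m \<and> b l = q. a l * A i l)" for i q
  have "0 < s * minor k Y r id" if "increasing k n r" for r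
    unfolding Y_def
  proof (rule minor_sum_blocks_pos)
    show "\<exists>l<m. b l = q \<and> 0 < a l" if "q < k" for q
    proof (cases "active q")
      case True
      then show ?thesis unfolding active_def by (auto simp: a_def active_def)
    next
      case False
      then show ?thesis using b(2)[OF that] by (auto simp: a_def)
    qed
  qed (use A[OF that] b in \<open>auto simp: a_def\<close>)
  moreover obtain l0 where l0: "l0 < m" "u l0 \<noteq> 0" using u by blast
  then have "active (b l0)" by (auto simp: active_def)
  then have "d (b l0) \<noteq> 0" using e[OF l0(1)] l0(2) by (auto simp: d_def)
  ultimately have *: "\<not> alternates_weakly k n (\<lambda>i. \<Sum>q<k. Y i q * d q)"
    using b(3)[OF l0(1)] not_alternates_weakly_of_minors[of k n s Y "b l0" d] by blast
  have ud: "u l = a l * d (b l)" if "l < m" for l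
  proof (cases "active (b l)")
    case True
    then show ?thesis using e[OF that] by (simp add: a_def d_def mult.commute)
  next
    case False
    then have "u l = 0" using that by (auto simp: active_def)
    then show ?thesis using False by (simp add: d_def)
  qed
  have "(\<Sum>l<m. A i l * u l) = (\<Sum>q<k. Y i q * d q)" for i
  proof -
    have "(\<Sum>q<k. Y i q * d q) = (\<Sum>q<k. \<Sum>l | l \<in> {..<m} \<and> b l = q. A i l * u l)"
      unfolding Y_def sum_distrib_right by (intro sum.cong) (auto simp: ud)
    also have "\<dots> = (\<Sum>l<m. A i l * u l)"
      by (rule sum.group) (auto simp: b(3))
    finally show ?thesis by simp
  qed
  with * show ?thesis by simp
qed

section \<open>Sufficient and necessary conditions for alternation\<close>

lemma obtain_enumeration:
  fixes L :: "nat set"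
  assumes "finite L" "card L = Suc k"
  obtains e where "strict_mono_on {..k} e" "e ` {..k} = L"
proof
  show e: "strict_mono_on {..k} (pick L)"
    using assms pick_mono_le[of _ L] by (auto intro!: strict_mono_onI)
  have "pick L ` {..k} \<subseteq> L" using assms pick_in_set_le[of _ L] by auto
  moreover have "card (pick L ` {..k}) = card L"
    using strict_mono_on_imp_inj_on[OF e] assms(2) by (simp add: card_image)
  ultimately show "pick L ` {..k} = L" using assms(1) by (metis card_subset_eq)
qed

text \<open>Neighbouring integers stay neighbours in an increasing enumeration, as nothing fits between them;
  this is why only steps by 1 are used to compare minors.\<close>

lemma consecutive_in_enumeration:
  assumes e: "strict_mono_on {..k} e" and "a \<in> e ` {..k}" "Suc a \<in> e ` {..k}"
  obtains p where "Suc p \<le> k" "e p = a" "e (Suc p) = Suc a"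
proof -
  obtain p q where p: "p \<le> k" "e p = a" and q: "q \<le> k" "e q = Suc a" using assms by fastforce
  have "e p < e q" using p q by simp
  then have "p < q" using strict_mono_on_less[OF e, of p q] p(1) q(1) by simp
  then have "e p < e (Suc p)" using strict_mono_onD[OF e, of p "Suc p"] q(1) by simp
  moreover have "e (Suc p) \<le> e q"
    using strict_mono_on_leD[OF e, of "Suc p" q] \<open>p < q\<close> q(1) by simp
  ultimately have "e (Suc p) = Suc a" using p q by simp
  then show ?thesis using that[of p] p q \<open>p < q\<close> by simp
qed

text \<open>Zeros can take any sign, so the sign of the single remaining entry can be accommodated.\<close>

lemma alternates_weakly_of_zeros:
  assumes "L \<subseteq> {..<n}" "card L = Suc k" "t \<in> L" "\<And>i. i \<in> L \<Longrightarrow> i \<noteq> t \<Longrightarrow> w i = 0"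
  shows "alternates_weakly k n w"
proof -
  have "finite L" using assms(1) finite_subset by blast
  then obtain e where e: "strict_mono_on {..k} e" "e ` {..k} = L"
    using obtain_enumeration assms(2) by blast
  then obtain p where p: "p \<le> k" "e p = t" using assms(3) by auto
  define s where "s = (-1) ^ p * (if w t \<ge> 0 then 1 else - 1 :: real)"
  have "0 \<le> s * (-1) ^ j * w (e j)" if "j \<le> k" for j
  proof (cases "e j = t")
    case True
    then have "j = p" using strict_mono_on_imp_inj_on[OF e(1)] p that by (auto dest: inj_onD)
    then show ?thesis using True by (cases "even p") (auto simp: s_def)
  next
    case False
    then show ?thesis using assms(4)[of "e j"] e(2) that by auto
  qed
  moreover have "s \<noteq> 0" by (simp add: s_def)
  ultimately show ?thesis
    unfolding alternates_weakly_def using e assms(1) by (intro exI[of _ e] exI[of _ s]) auto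
qed

text \<open>Neighbouring positions are consecutive in the enumeration of \<open>L\<close>, so two entries there without a
  common strict sign fit into an alternating pattern, and the zeros fill in the rest.\<close>

lemma alternates_weakly_of_consecutive:
  assumes "L \<subseteq> {..<n}" "card L = Suc k" "a \<in> L" "Suc a \<in> L"
    and zero: "\<And>i. i \<in> L \<Longrightarrow> i \<noteq> a \<Longrightarrow> i \<noteq> Suc a \<Longrightarrow> w i = 0" and opp: "w a * w (Suc a) \<le> 0"
    and nz: "w (Suc a) \<noteq> 0"
  shows "alternates_weakly k n w"
proof -
  have "finite L" using assms(1) finite_subset by blast
  then obtain e where e: "strict_mono_on {..k} e" "e ` {..k} = L"
    using obtain_enumeration assms(2) by blast
  obtain p where p: "Suc p \<le> k" "e p = a" "e (Suc p) = Suc a"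
    using consecutive_in_enumeration[OF e(1)] assms(3,4) e(2) by metis
  define s where "s = - ((-1) ^ p * w (Suc a))"
  have inj: "inj_on e {..k}" using strict_mono_on_imp_inj_on[OF e(1)] .
  have "0 \<le> s * (-1) ^ j * w (e j)" if "j \<le> k" for j
  proof -
    consider "e j = a" | "e j = Suc a" | "e j \<noteq> a" "e j \<noteq> Suc a" by blast
    then show ?thesis
    proof cases
      case 1
      then have "j = p" using inj p that by (auto dest: inj_onD)
      then show ?thesis using 1 opp by (cases "even p") (auto simp: s_def mult.commute)
    next
      case 2
      then have "j = Suc p" using inj p that by (metis atMost_iff inj_onD)
      then show ?thesis using 2 by (cases "even p") (auto simp: s_def)
    next
      case 3
      then show ?thesis using zero[of "e j"] e(2) that by auto
    qed
  qed
  moreover have "s \<noteq> 0" using nz by (simp add: s_def)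
  ultimately show ?thesis
    unfolding alternates_weakly_def using e assms(1) by (intro exI[of _ e] exI[of _ s]) auto
qed

text \<open>A strictly alternating subsequence of length \<open>k + 1\<close> uses only nonzero entries. If these lie in a
  set \<open>L\<close> of at most \<open>k + 1\<close> positions, the subsequence must exhaust \<open>L\<close>.\<close>

lemma alternates_strictly_support:
  assumes "finite L" "card L \<le> Suc k" "\<And>i. i < m \<Longrightarrow> u i \<noteq> 0 \<Longrightarrow> i \<in> L" "alternates_strictly k m u"
  obtains e s where "strict_mono_on {..k} e" "e ` {..k} = L" "card L = Suc k"
    "\<And>j. j \<le> k \<Longrightarrow> 0 < s * (-1) ^ j * u (e j)"
proof -
  obtain e s where e: "strict_mono_on {..k} e" "e ` {..k} \<subseteq> {..<m}"
    and s: "\<And>j. j \<le> k \<Longrightarrow> 0 < s * (-1) ^ j * u (e j)"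
    using assms(4) unfolding alternates_strictly_def by blast
  have "u (e j) \<noteq> 0" if "j \<le> k" for j using s[OF that] by auto
  then have sub: "e ` {..k} \<subseteq> L" using assms(3) e(2) by auto
  have "card (e ` {..k}) = Suc k"
    using strict_mono_on_imp_inj_on[OF e(1)] by (simp add: card_image)
  then have "card L = Suc k" "e ` {..k} = L"
    using card_mono[OF assms(1) sub] assms(2) card_subset_eq[OF assms(1) sub] by simp_all
  then show ?thesis using that e(1) s by blast
qed

lemma not_alternates_strictly_small_support:
  assumes "finite L" "card L \<le> k" "\<And>i. i < m \<Longrightarrow> u i \<noteq> 0 \<Longrightarrow> i \<in> L"
  shows "\<not> alternates_strictly k m u"
proof
  assume "alternates_strictly k m u"
  with assms show False by (elim alternates_strictly_support[of L, rotated 3]) auto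
qed

lemma not_alternates_strictly_of_consecutive:
  assumes "finite L" "card L \<le> Suc k" "\<And>i. i < m \<Longrightarrow> u i \<noteq> 0 \<Longrightarrow> i \<in> L"
    and "a \<in> L" "Suc a \<in> L" and same: "0 \<le> u a * u (Suc a)"
  shows "\<not> alternates_strictly k m u"
proof
  assume "alternates_strictly k m u"
  then obtain e s where e: "strict_mono_on {..k} e" "e ` {..k} = L"
    and s: "\<And>j. j \<le> k \<Longrightarrow> 0 < s * (-1) ^ j * u (e j)"
    using alternates_strictly_support[OF assms(1-3)] by metis
  obtain p where p: "Suc p \<le> k" "e p = a" "e (Suc p) = Suc a"
    using consecutive_in_enumeration[OF e(1)] assms(4,5) e(2) by metis
  define t where "t = s * (-1) ^ p"
  have "0 < t * u a" "0 < - t * u (Suc a)"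
    using s[of p] s[of "Suc p"] p by (simp_all add: t_def)
  then show False using same by (auto simp: zero_less_mult_iff zero_le_mult_iff mult_less_0_iff)
qed

section \<open>Moving one index at a time\<close>

text \<open>Every increasing selection can be moved to the initial one by lowering one index at a
  time by 1: take the first index that differs from its initial value. Hence two minors can be
  compared along steps that change a single row or column by 1.\<close>

lemma increasing_induct [consumes 1, case_names initial step]:
  assumes "increasing k n r"
    and initial: "\<And>r. (\<And>i. i < k \<Longrightarrow> r i = i) \<Longrightarrow> P r"
    and step: "\<And>r j a. increasing k n r \<Longrightarrow> j < k \<Longrightarrow> r j = Suc a \<Longrightarrow> increasing k n (r(j := a)) \<Longrightarrow>
      P (r(j := a)) \<Longrightarrow> P r"
  shows "P r"
  using assms(1)
proof (induction "\<Sum>i<k. r i" arbitrary: r rule: less_induct)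
  case less
  show ?case
  proof (cases "\<exists>i<k. r i \<noteq> i")
    case False
    then show ?thesis by (intro initial) auto
  next
    case True
    define j where "j = (LEAST i. i < k \<and> r i \<noteq> i)"
    have j: "j < k" "r j \<noteq> j" using LeastI_ex[OF True[unfolded]] unfolding j_def by auto
    have before: "r i = i" if "i < j" for i
      using not_less_Least[of i "\<lambda>i. i < k \<and> r i \<noteq> i"] that j(1) unfolding j_def by auto
    note r = increasingD[OF less.prems]
    have "j \<le> r j"
    proof (cases j)
      case (Suc i)
      then show ?thesis using r(1)[of i j] before[of i] j(1) by simp
    qed simp
    then have "j < r j" using j(2) by simp
    then obtain a where a: "r j = Suc a" "j \<le> a" by (cases "r j") auto
    have "increasing k n (r(j := a))"
      unfolding increasing_def
    proof
      show "strict_mono_on {..<k} (r(j := a))"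
      proof (rule strict_mono_onI)
        fix p q assume "p \<in> {..<k}" "q \<in> {..<k}" "p < q"
        then show "(r(j := a)) p < (r(j := a)) q"
          using r(1)[of p q] before[of p] a by (auto simp: less_Suc_eq)
      qed
      show "(r(j := a)) ` {..<k} \<subseteq> {..<n}"
        using r(2) a(1) j(1) by (fastforce simp: image_subset_iff)
    qed
    moreover have "(\<Sum>i<k. (r(j := a)) i) < (\<Sum>i<k. r i)"
      using j(1) a(1) by (intro sum_strict_mono_ex1) auto
    ultimately show ?thesis using step less j(1) a(1) by blast
  qed
qed

section \<open>Combinations of selected columns\<close>

text \<open>For injective \<open>c\<close> this is the vector with entry \<open>x q\<close> at position \<open>c q\<close> and zeros elsewhere; the sum makes
  \<open>sum_scatter\<close> hold without injectivity.\<close>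

definition scatter :: "nat \<Rightarrow> (nat \<Rightarrow> nat) \<Rightarrow> (nat \<Rightarrow> real) \<Rightarrow> nat \<Rightarrow> real" where
  "scatter k c x l = (\<Sum>q<k. if c q = l then x q else 0)"

lemma sum_scatter:
  assumes "c ` {..<k} \<subseteq> {..<m}"
  shows "(\<Sum>l<m. f l * scatter k c x l) = (\<Sum>q<k. f (c q) * x q)"
proof -
  have "(\<Sum>l<m. f l * scatter k c x l) = (\<Sum>l<m. \<Sum>q<k. if c q = l then f l * x q else 0)"
    by (auto simp: scatter_def sum_distrib_left intro!: sum.cong)
  also have "\<dots> = (\<Sum>q<k. \<Sum>l<m. if c q = l then f l * x q else 0)" by (rule sum.swap)
  also have "\<dots> = (\<Sum>q<k. f (c q) * x q)"
    using assms by (intro sum.cong) auto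
  finally show ?thesis .
qed

lemma scatter_outside: "l \<notin> c ` {..<k} \<Longrightarrow> scatter k c x l = 0"
  unfolding scatter_def by (rule sum.neutral) auto

lemma scatter_at:
  assumes "inj_on c {..<k}" "q < k"
  shows "scatter k c x (c q) = x q"
proof -
  have "scatter k c x (c q) = (\<Sum>p<k. if p = q then x p else 0)"
    unfolding scatter_def using assms by (intro sum.cong refl) (auto dest: inj_onD)
  then show ?thesis using assms(2) by simp
qed

text \<open>The coefficients are the cofactors of row \<open>j\<close>, which do not involve the entries of that row. So all
  minors that arise by replacing row \<open>j\<close> are the entries of one vector \<open>A u\<close>, with \<open>u\<close> supported on the
  columns \<open>c\<close>.\<close>

lemma minor_row_update_linear:
  assumes "j < k"
  obtains x where "\<And>t. minor k A (r(j := t)) c = (\<Sum>q<k. A t (c q) * x q)"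
proof
  fix t
  let ?M = "\<lambda>r. mat k k (\<lambda>(i, j). A (r i) (c j))"
  have "cofactor (?M (r(j := t))) j q = cofactor (?M r) j q" for q
    unfolding cofactor_def
    by (intro arg_cong2[of _ _ _ _ "(*)"] refl arg_cong[of _ _ det] eq_matI)
      (auto simp: mat_delete_def)
  then show "minor k A (r(j := t)) c = (\<Sum>q<k. A t (c q) * cofactor (?M r) j q)"
    unfolding minor_def using assms by (subst laplace_expansion_row[of _ k j]) auto
qed

lemma minor_equal_rows:
  assumes "i < k" "j < k" "i \<noteq> j"
  shows "minor k A (r(j := r i)) c = 0"
  unfolding minor_def using assms
  by (intro det_identical_rows[of _ k i j]) auto

text \<open>Column \<open>a\<close> is a combination of the selected columns, and Cramer's rule gives its coefficients as
  quotients of minors. This supplies a kernel vector on \<open>k + 1\<close> columns with known signs.\<close>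

lemma minor_cramer:
  fixes A :: "nat \<Rightarrow> nat \<Rightarrow> real"
  assumes "minor k A r c \<noteq> 0"
  obtains x where "\<And>p. p < k \<Longrightarrow> (\<Sum>q<k. A (r p) (c q) * x q) = A (r p) a"
    "\<And>j. j < k \<Longrightarrow> minor k A r (c(j := a)) = x j * minor k A r c"
proof -
  let ?M = "mat k k (\<lambda>(i, j). A (r i) (c j))"
  let ?D = "minor k A r c"
  define v where "v = vec k (\<lambda>p. A (r p) a)"
  define y where "y = inverse ?D \<cdot>\<^sub>v (adj_mat ?M *\<^sub>v v)"
  have M: "?M \<in> carrier_mat k k" and v: "v \<in> carrier_vec k" by (simp_all add: v_def)
  note adj = adj_mat[OF M]
  have y: "y \<in> carrier_vec k" using adj(1) v by (simp add: y_def)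
  have "?M *\<^sub>v y = inverse ?D \<cdot>\<^sub>v (?M *\<^sub>v (adj_mat ?M *\<^sub>v v))"
    unfolding y_def using M adj(1) v by (intro mult_mat_vec) auto
  also have "?M *\<^sub>v (adj_mat ?M *\<^sub>v v) = (?M * adj_mat ?M) *\<^sub>v v"
    by (rule assoc_mult_mat_vec[OF M adj(1) v, symmetric])
  also have "\<dots> = ?D \<cdot>\<^sub>v v"
    unfolding adj(2) minor_def using v by (intro eq_vecI) (auto simp: row_smult)
  finally have My: "?M *\<^sub>v y = v" using assms v by (simp add: smult_smult_assoc)
  show ?thesis
  proof (rule that[of "($) y"])
    fix p assume "p < k"
    have "(?M *\<^sub>v y) $ p = (\<Sum>q<k. A (r p) (c q) * y $ q)"
      using y \<open>p < k\<close> by (auto simp: scalar_prod_def atLeast0LessThan intro!: sum.cong)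
    then show "(\<Sum>q<k. A (r p) (c q) * y $ q) = A (r p) a"
      using \<open>p < k\<close> unfolding My by (simp add: v_def)
  next
    fix j assume "j < k"
    have "replace_col ?M v j = mat k k (\<lambda>(i, l). A (r i) ((c(j := a)) l))"
      by (intro eq_matI) (auto simp: replace_col_def v_def)
    then show "minor k A r (c(j := a)) = y $ j * ?D"
      using cramer_lemma_mat[OF M y \<open>j < k\<close>] unfolding My minor_def by simp
  qed
qed

section \<open>From variation bounding to sign consistency\<close>

text \<open>Each way in which the minors could fail to have one sign produces a vector \<open>u\<close> with fewer than
  \<open>k\<close> sign changes such that \<open>A u\<close> alternates weakly \<open>k\<close> times. A vanishing minor gives a kernel vector
  supported on \<open>k\<close> columns. A sign change when one row index moves by 1 gives a vector \<open>u\<close> of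
  cofactors, also supported on \<open>k\<close> columns, such that \<open>A u\<close> has opposite signs at the two rows and
  zeros at the other selected ones. A sign change when one column index moves by 1 gives a kernel
  vector on \<open>k + 1\<close> columns with equal signs at two neighbours. As such moves connect all
  selections, all minors have the same sign.\<close>

lemma bounding_imp_sign_consistent:
  fixes A :: "nat \<Rightarrow> nat \<Rightarrow> real"
  assumes bd: "\<And>u. \<exists>l<m. u l \<noteq> 0 \<Longrightarrow> \<not> alternates_strictly k m u \<Longrightarrow>
      \<not> alternates_weakly k n (\<lambda>i. \<Sum>l<m. A i l * u l)"
    and "k < n" "k \<le> m"
  shows "\<exists>s. \<forall>r c. increasing k n r \<longrightarrow> increasing k m c \<longrightarrow> 0 < s * minor k A r c"
proof -
  \<comment> \<open>The \<open>k\<close> zeros together with one further row, which exists as \<open>k < n\<close>, alternate weakly.\<close>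
  have zeros: "alternates_weakly k n w"
    if r: "increasing k n r" and w: "\<And>i. i < k \<Longrightarrow> w (r i) = 0" for r w
  proof -
    let ?I = "r ` {..<k}"
    have I: "?I \<subseteq> {..<n}" "card ?I = k"
      using r increasingD(3)[OF r] by (simp_all add: increasing_def card_image)
    then have "?I \<noteq> {..<n}" using \<open>k < n\<close> by auto
    then obtain t where "t < n" "t \<notin> ?I" using I(1) by blast
    then show ?thesis using I w by (intro alternates_weakly_of_zeros[of "insert t ?I" n k t]) auto
  qed
  have nz: "minor k A r c \<noteq> 0" if r: "increasing k n r" and c: "increasing k m c" for r c
  proof
    assume "minor k A r c = 0"
    then obtain x q where q: "q < k" "x q \<noteq> 0" and x: "\<And>p. p < k \<Longrightarrow> (\<Sum>q<k. A (r p) (c q) * x q) = 0"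
      unfolding minor_eq_0_iff_kernel by blast
    let ?u = "scatter k c x"
    have cm: "c ` {..<k} \<subseteq> {..<m}" using c by (simp add: increasing_def)
    have "\<exists>l<m. ?u l \<noteq> 0"
      using q scatter_at[OF increasingD(3)[OF c] q(1)] increasingD(2)[OF c q(1)] by metis
    moreover have "\<not> alternates_strictly k m ?u"
      using scatter_outside[of _ c k x] card_image_le[of "{..<k}" c]
      by (intro not_alternates_strictly_small_support[of "c ` {..<k}"]) auto
    ultimately have "\<not> alternates_weakly k n (\<lambda>i. \<Sum>l<m. A i l * ?u l)" by (rule bd)
    then show False using zeros[OF r] x by (simp add: sum_scatter[OF cm])
  qed
  have square_pos: "0 < y * y" if "y \<noteq> 0" for y :: real
    using that not_real_square_gt_zero by blast
  \<comment> \<open>The lowered index is new: otherwise the lowered selection would repeat it.\<close>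
  have fresh: "a \<notin> r ` {..<k}" "card (insert a (r ` {..<k})) = Suc k"
    if r: "increasing k N r" and j: "j < k" "r j = Suc a" and r': "increasing k N (r(j := a))"
    for r j a N
  proof -
    show "a \<notin> r ` {..<k}"
    proof
      assume "a \<in> r ` {..<k}"
      then obtain i where i: "i < k" "r i = a" by auto
      then have "i \<noteq> j" "(r(j := a)) i = (r(j := a)) j" using j by auto
      then show False using inj_onD[OF increasingD(3)[OF r']] i j by blast
    qed
    then show "card (insert a (r ` {..<k})) = Suc k"
      using increasingD(3)[OF r] by (simp add: card_image)
  qed
  have row: "0 < minor k A (r(j := a)) c * minor k A r c"
    if r: "increasing k n r" and j: "j < k" "r j = Suc a" and r': "increasing k n (r(j := a))"
      and c: "increasing k m c" for r j a c
  proof (rule ccontr)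
    assume neg: "\<not> ?thesis"
    obtain x where x: "\<And>t. minor k A (r(j := t)) c = (\<Sum>q<k. A t (c q) * x q)"
      using minor_row_update_linear[OF j(1)] by blast
    let ?u = "scatter k c x"
    have cm: "c ` {..<k} \<subseteq> {..<m}" using c by (simp add: increasing_def)
    have w: "(\<Sum>l<m. A t l * ?u l) = minor k A (r(j := t)) c" for t
      using x by (simp add: sum_scatter[OF cm])
    have wj: "minor k A (r(j := Suc a)) c = minor k A r c" using j by (metis fun_upd_triv)
    have "\<exists>l<m. ?u l \<noteq> 0"
    proof (rule ccontr)
      assume "\<not> ?thesis"
      then have "minor k A r c = 0" using w[of "Suc a"] wj by simp
      then show False using nz[OF r c] by simp
    qed
    moreover have "\<not> alternates_strictly k m ?u"
      using scatter_outside[of _ c k x] card_image_le[of "{..<k}" c]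
      by (intro not_alternates_strictly_small_support[of "c ` {..<k}"]) auto
    ultimately have "\<not> alternates_weakly k n (\<lambda>i. \<Sum>l<m. A i l * ?u l)" by (rule bd)
    moreover have "alternates_weakly k n (\<lambda>i. \<Sum>l<m. A i l * ?u l)"
      unfolding w
    proof (rule alternates_weakly_of_consecutive[of "insert a (r ` {..<k})" _ _ a])
      show "insert a (r ` {..<k}) \<subseteq> {..<n}"
        using r increasingD(2)[OF r j(1)] j(2) by (auto simp: increasing_def)
      show "Suc a \<in> insert a (r ` {..<k})" using j by force
      show "minor k A (r(j := i)) c = 0"
        if "i \<in> insert a (r ` {..<k})" "i \<noteq> a" "i \<noteq> Suc a" for i
        using that j minor_equal_rows[of _ k j A r c] by auto
    qed (use neg wj nz[OF r c] fresh[OF r j r'] in auto)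
    ultimately show False ..
  qed
  have col: "0 < minor k A r (c(j := a)) * minor k A r c"
    if c: "increasing k m c" and j: "j < k" "c j = Suc a" and c': "increasing k m (c(j := a))"
      and r: "increasing k n r" for r j a c
  proof -
    obtain x where x: "\<And>p. p < k \<Longrightarrow> (\<Sum>q<k. A (r p) (c q) * x q) = A (r p) a"
      and cramer: "minor k A r (c(j := a)) = x j * minor k A r c"
      using minor_cramer[OF nz[OF r c], of a] j(1) by metis
    \<comment> \<open>This is a kernel vector for the rows \<open>r\<close>: column \<open>a\<close> minus its expansion cancels.
      At the neighbours \<open>a\<close> and \<open>Suc a = c j\<close> its entries are \<open>- 1\<close> and \<open>x j\<close>.\<close>
    let ?u = "\<lambda>l. scatter k c x l - (if l = a then 1 else 0)"
    have cm: "c ` {..<k} \<subseteq> {..<m}" using c by (simp add: increasing_def)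
    have "a < m" using increasingD(2)[OF c j(1)] j(2) by simp
    have ua: "?u a = - 1" using scatter_outside[OF fresh(1)[OF c j c']] by simp
    have uj: "?u (Suc a) = x j" using scatter_at[OF increasingD(3)[OF c] j(1), of x] j(2) by simp
    have "0 < x j"
    proof (rule ccontr)
      assume "\<not> 0 < x j"
      have "\<exists>l<m. ?u l \<noteq> 0" using \<open>a < m\<close> ua by (intro exI[of _ a]) simp
      moreover have "\<not> alternates_strictly k m ?u"
      proof (rule not_alternates_strictly_of_consecutive[of "insert a (c ` {..<k})" _ _ _ a])
        show "Suc a \<in> insert a (c ` {..<k})" using j by force
        show "0 \<le> ?u a * ?u (Suc a)" unfolding ua uj using \<open>\<not> 0 < x j\<close> by simp
        show "i \<in> insert a (c ` {..<k})" if "?u i \<noteq> 0" for i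
          using that scatter_outside[of i c k x] by (auto split: if_splits)
      qed (use fresh[OF c j c'] in auto)
      ultimately have "\<not> alternates_weakly k n (\<lambda>i. \<Sum>l<m. A i l * ?u l)" by (rule bd)
      moreover have "(\<Sum>l<m. A (r p) l * ?u l) = 0" if "p < k" for p
      proof -
        have "(\<Sum>l<m. A (r p) l * ?u l) =
            (\<Sum>l<m. A (r p) l * scatter k c x l) - (\<Sum>l<m. A (r p) l * (if l = a then 1 else 0))"
          by (simp only: right_diff_distrib sum_subtractf)
        also have "(\<Sum>l<m. A (r p) l * (if l = a then 1 else 0)) = (\<Sum>l<m. if l = a then A (r p) l else 0)"
          by (intro sum.cong) auto
        also have "(\<Sum>l<m. A (r p) l * scatter k c x l) - \<dots> = 0"
          using x[OF that] \<open>a < m\<close> by (simp add: sum_scatter[OF cm])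
        finally show ?thesis .
      qed
      ultimately show False using zeros[OF r] by simp
    qed
    then show ?thesis
      using square_pos[OF nz[OF r c]] unfolding cramer by (simp add: mult.assoc)
  qed
  have chain: "0 < x * z" if "0 < x * y" "0 < y * z" for x y z :: real
    using that by (auto simp: zero_less_mult_iff)
  have id: "increasing k n id" "increasing k m id"
    using \<open>k < n\<close> \<open>k \<le> m\<close> by (auto simp: increasing_def intro: strict_mono_onI)
  let ?s = "minor k A id id"
  have sc: "0 < ?s * minor k A id c" if "increasing k m c" for c
    using that
  proof (induction rule: increasing_induct)
    case (initial c)
    then have "minor k A id c = ?s" by (intro minor_cong) auto
    then show ?case using square_pos[OF nz[OF id]] by (simp only:)
  next
    case (step c j a)
    show ?case by (rule chain[OF step.IH col[OF step.hyps id(1)]])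
  qed
  have rc: "0 < ?s * minor k A r c" if c: "increasing k m c" and "increasing k n r" for r c
    using that(2)
  proof (induction rule: increasing_induct)
    case (initial r)
    then have "minor k A r c = minor k A id c" by (intro minor_cong) auto
    then show ?case using sc[OF c] by (simp only:)
  next
    case (step r j a)
    show ?case by (rule chain[OF step.IH row[OF step.hyps c]])
  qed
  show ?thesis by (intro exI[of _ ?s] allI impI) (rule rc)
qed

section \<open>The equivalence\<close>

theorem proposition9:
  fixes X :: "real mat" and n m k :: nat
  assumes "X \<in> carrier_mat n m"
    and "k \<ge> 1"
    and "k < min (m + 1) n"
  shows "strictly_sign_consistent k X \<longleftrightarrow> strictly_variation_bounding (k - 1) X"
proof -
  have km: "k \<le> m" "k < n" "0 < n" using assms(3) by auto
  show ?thesis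
    unfolding strictly_sign_consistent_iff_minor[OF assms(1)]
      strictly_variation_bounding_iff_alternates[OF assms(1,2) \<open>0 < n\<close>]
  proof
    assume "\<exists>s. \<forall>r c. increasing k n r \<longrightarrow> increasing k m c \<longrightarrow> 0 < s * minor k (\<lambda>i j. X $$ (i, j)) r c"
    then obtain s where
      "\<And>r c. increasing k n r \<Longrightarrow> increasing k m c \<Longrightarrow> 0 < s * minor k (\<lambda>i j. X $$ (i, j)) r c"
      by blast
    then show "\<forall>u. (\<exists>l<m. u l \<noteq> 0) \<longrightarrow> \<not> alternates_strictly k m u \<longrightarrow>
        \<not> alternates_weakly k n (\<lambda>i. \<Sum>l<m. X $$ (i, l) * u l)"
      using km(1) by (intro allI impI sign_consistent_imp_bounding)
  next
    assume bounding: "\<forall>u. (\<exists>l<m. u l \<noteq> 0) \<longrightarrow> \<not> alternates_strictly k m u \<longrightarrow>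
        \<not> alternates_weakly k n (\<lambda>i. \<Sum>l<m. X $$ (i, l) * u l)"
    show "\<exists>s. \<forall>r c. increasing k n r \<longrightarrow> increasing k m c \<longrightarrow>
        0 < s * minor k (\<lambda>i j. X $$ (i, j)) r c"
      by (rule bounding_imp_sign_consistent[OF bounding[rule_format] km(2,1)])
  qed
qed

end
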